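(* Let $\mathfrak a$ be a Euclidean vector space and let $V\subset\mathfrak{so}(\mathfrak a)$ be a nonzero linear subspace with an inner product $\langle\cdot,\cdot\rangle$ such that $V$ is non-singular and $(V,\langle\cdot,\cdot\rangle)$ is a GO-pair of centralizer type. Then one of the following holds: (a) $\dim V=1$ and $V$ is spanned by a non-singular skew-symmetric matrix; (b) $\dim V\in\{2,3\}$ and there is an orthogonal decomposition $\mathfrak a=\bigoplus_{i=1}^pU_i$ with $\dim U_i=4$, together with a choice, for each $i$, of one of the two ideals $\mathfrak s_i\cong\mathfrak{so}(3)$ in $\mathfrak{so}(U_i)\simeq\mathfrak{so}(4)=\mathfrak s_i\oplus\mathfrak s_i'$, such that $V\subset\bigoplus_{i=1}^p\mathfrak s_i$ and every projection $\pi_i:V\to\mathfrak s_i$ is injective.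
   Context: $\mathfrak{so}(\mathfrak a)$ is the Lie algebra of skew-symmetric endomorphisms of the finite-dimensional real Euclidean space $\mathfrak a$. For a linear subspace $V\subset\mathfrak{so}(\mathfrak a)$ let $\mathcal C(V)=\{A\in\mathfrak{so}(\mathfrak a)\mid[A,V]=0\}$. A pair $(V,\langle\cdot,\cdot\rangle)$ is a GO-pair of centralizer type if for every $J\in V$ and $X\in\mathfrak a$ there exists $N\in\mathcal C(V)$ with $NX=JX$ (this does not depend on the inner product). $V$ is non-singular if every nonzero element of $V$ is invertible. For a subspace $U\subset\mathfrak a$, $\mathfrak{so}(U)$ is regarded as the subalgebra of elements of $\mathfrak{so}(\mathfrak a)$ that vanish on $U^\perp$. *)

theory Defs
  imports "HOL-Analysis.Analysis"
begin

text \<open>Endomorphisms of a Euclidean space are represented by the type of bounded linear maps; in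
  finite dimension boundedness is automatic.\<close>

type_synonym 'a endo = "'a \<Rightarrow>\<^sub>L 'a"

definition so :: "'a::euclidean_space endo set" where
  "so = {A. \<forall>x y. inner (blinfun_apply A x) y = - inner x (blinfun_apply A y)}"

definition lie_bracket :: "'a::euclidean_space endo \<Rightarrow> 'a endo \<Rightarrow> 'a endo" where
  "lie_bracket A B = (A o\<^sub>L B) - (B o\<^sub>L A)"

definition so_on :: "'a::euclidean_space set \<Rightarrow> 'a endo set" where
  "so_on U = {A \<in> so. \<forall>x \<in> U\<^sup>\<bottom>. blinfun_apply A x = 0}"

definition so_centralizer :: "'a::euclidean_space endo set \<Rightarrow> 'a endo set" where
  "so_centralizer V = {A \<in> so. \<forall>B \<in> V. lie_bracket A B = 0}"

definition endo_invertible :: "'a::euclidean_space endo \<Rightarrow> bool" where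
  "endo_invertible A \<longleftrightarrow> (\<exists>B. A o\<^sub>L B = id_blinfun \<and> B o\<^sub>L A = id_blinfun)"

definition non_singular :: "'a::euclidean_space endo set \<Rightarrow> bool" where
  "non_singular V \<longleftrightarrow> (\<forall>A \<in> V. A \<noteq> 0 \<longrightarrow> endo_invertible A)"

text \<open>Only the values of \<open>ip\<close> on the subspace \<open>V\<close> are constrained.\<close>

definition inner_product_on :: "'v::real_vector set \<Rightarrow> ('v \<Rightarrow> 'v \<Rightarrow> real) \<Rightarrow> bool" where
  "inner_product_on V ip \<longleftrightarrow>
     (\<forall>x\<in>V. \<forall>y\<in>V. ip x y = ip y x) \<and>
     (\<forall>x\<in>V. \<forall>y\<in>V. \<forall>z\<in>V. ip (x + y) z = ip x z + ip y z) \<and>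
     (\<forall>c. \<forall>x\<in>V. \<forall>y\<in>V. ip (c *\<^sub>R x) y = c * ip x y) \<and>
     (\<forall>x\<in>V. x \<noteq> 0 \<longrightarrow> ip x x > 0)"

text \<open>The inner product does not enter the centralizer condition itself; it is carried along as
  the second component of the pair.\<close>

definition GO_pair_centralizer_type ::
    "'a::euclidean_space endo set \<Rightarrow> ('a endo \<Rightarrow> 'a endo \<Rightarrow> real) \<Rightarrow> bool" where
  "GO_pair_centralizer_type V ip \<longleftrightarrow>
     inner_product_on V ip \<and>
     (\<forall>J\<in>V. \<forall>x. \<exists>N \<in> so_centralizer V. blinfun_apply N x = blinfun_apply J x)"

definition lie_ideal :: "'a::euclidean_space endo set \<Rightarrow> 'a endo set \<Rightarrow> bool" where
  "lie_ideal I L \<longleftrightarrow> subspace I \<and> I \<subseteq> L \<and> (\<forall>A\<in>L. \<forall>B\<in>I. lie_bracket A B \<in> I)"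

definition lie_isomorphic :: "'a::euclidean_space endo set \<Rightarrow> 'b::euclidean_space endo set \<Rightarrow> bool" where
  "lie_isomorphic L M \<longleftrightarrow>
     (\<exists>\<phi>. bij_betw \<phi> L M \<and>
          (\<forall>A\<in>L. \<forall>B\<in>L. \<phi> (A + B) = \<phi> A + \<phi> B) \<and>
          (\<forall>c. \<forall>A\<in>L. \<phi> (c *\<^sub>R A) = c *\<^sub>R \<phi> A) \<and>
          (\<forall>A\<in>L. \<forall>B\<in>L. \<phi> (lie_bracket A B) = lie_bracket (\<phi> A) (\<phi> B)))"

definition subspace_sum :: "'i set \<Rightarrow> ('i \<Rightarrow> 'v::real_vector set) \<Rightarrow> 'v set" where
  "subspace_sum I S = {sum f I |f. \<forall>i\<in>I. f i \<in> S i}"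

definition independent_subspaces :: "'i set \<Rightarrow> ('i \<Rightarrow> 'v::real_vector set) \<Rightarrow> bool" where
  "independent_subspaces I S \<longleftrightarrow>
     (\<forall>i\<in>I. subspace (S i)) \<and>
     (\<forall>f. (\<forall>i\<in>I. f i \<in> S i) \<and> sum f I = 0 \<longrightarrow> (\<forall>i\<in>I. f i = 0))"

definition internal_direct_sum :: "'v::real_vector set \<Rightarrow> 'i set \<Rightarrow> ('i \<Rightarrow> 'v set) \<Rightarrow> bool" where
  "internal_direct_sum W I S \<longleftrightarrow> finite I \<and> independent_subspaces I S \<and> W = subspace_sum I S"

text \<open>Projection of a direct sum onto its \<open>i\<close>-th summand; meaningful only for arguments in the sum
  of an independent family.\<close>

definition summand_proj :: "'i set \<Rightarrow> ('i \<Rightarrow> 'v::real_vector set) \<Rightarrow> 'i \<Rightarrow> 'v \<Rightarrow> 'v" where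
  "summand_proj I S i x = (THE w. \<exists>f. (\<forall>j\<in>I. f j \<in> S j) \<and> x = sum f I \<and> w = f i)"

lemma summand_proj_sum:
  assumes "independent_subspaces I S" "\<forall>j\<in>I. f j \<in> S j" "i \<in> I"
  shows "summand_proj I S i (sum f I) = f i"
  unfolding summand_proj_def
proof (rule the_equality)
  show "\<exists>g. (\<forall>j\<in>I. g j \<in> S j) \<and> sum f I = sum g I \<and> f i = g i"
    using assms(2) by blast
next
  fix w assume "\<exists>g. (\<forall>j\<in>I. g j \<in> S j) \<and> sum f I = sum g I \<and> w = g i"
  then obtain g where g: "\<forall>j\<in>I. g j \<in> S j" "sum f I = sum g I" "w = g i"
    by blast
  have "\<forall>j\<in>I. g j - f j \<in> S j"
    using assms(1,2) g(1) by (auto simp: independent_subspaces_def intro: subspace_diff)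
  moreover have "(\<Sum>j\<in>I. g j - f j) = 0"
    using g(2) by (simp add: sum_subtractf)
  ultimately have "\<forall>j\<in>I. g j - f j = 0"
    using assms(1) unfolding independent_subspaces_def
    by (metis (no_types, lifting))
  then show "w = f i"
    using g(3) assms(3) by auto
qed

definition orthogonal_decomposition :: "'i set \<Rightarrow> ('i \<Rightarrow> 'a::euclidean_space set) \<Rightarrow> bool" where
  "orthogonal_decomposition I U \<longleftrightarrow>
     internal_direct_sum UNIV I U \<and>
     (\<forall>i\<in>I. \<forall>j\<in>I. i \<noteq> j \<longrightarrow> (\<forall>x\<in>U i. \<forall>y\<in>U j. orthogonal x y))"

text \<open>For a four-dimensional subspace \<open>U\<close>: \<open>s\<close> is one of the two ideals, isomorphic to the Lie
  algebra \<open>so\<close> of Euclidean 3-space, whose direct sum is \<open>so_on U\<close>.\<close>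

definition so3_ideal_of_so4 :: "'a::euclidean_space endo set \<Rightarrow> 'a set \<Rightarrow> bool" where
  "so3_ideal_of_so4 s U \<longleftrightarrow>
     lie_ideal s (so_on U) \<and> lie_isomorphic s (so :: (real^3) endo set) \<and>
     (\<exists>s'. lie_ideal s' (so_on U) \<and> lie_isomorphic s' (so :: (real^3) endo set) \<and>
           s \<inter> s' = {0} \<and> so_on U = {A + B |A B. A \<in> s \<and> B \<in> s'})"

end

theory Submission
  imports Defs
begin

text \<open>Let \<open>W\<close> be a minimal nonzero \<open>V\<close>-invariant subspace and \<open>x \<in> W\<close> a unit vector. Compressing to
  \<open>W\<close> the elements of the centralizer given by the hypothesis, every \<open>J \<in> V\<close> has a partner \<open>n\<close>,
  skew on \<open>W\<close> and commuting with \<open>V\<close> there, such that \<open>n x = J x\<close>. By irreducibility symmetric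
  operators on \<open>W\<close> commuting with \<open>V\<close> are scalar, so these partners satisfy the Clifford relation
  \<open>n m + m n = -2 \<langle>n x, m x\<rangle>\<close>. If \<open>V\<close> contains two independent elements, their partners generate a
  copy of the quaternions; anything anticommuting with \<open>n1\<close>, \<open>n2\<close> and \<open>n1 n2\<close> vanishes, hence
  \<open>x, n1 x, n2 x, n1 n2 x\<close> span a \<open>V\<close>-invariant space, which is all of \<open>W\<close>. In this frame the partners
  act as left and \<open>V\<close> as right multiplications by imaginary quaternions. Passing to orthogonal
  complements yields the decomposition. If \<open>V\<close> has no two independent elements, it is a line.\<close>

section \<open>The two ideals of so(4)\<close>

text \<open>For orthonormal \<open>a\<close>, \<open>b\<close> this is the quarter turn taking
  \<open>a\<close> to \<open>b\<close> in their plane and killing the orthogonal complement of that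
  plane.\<close>

definition wedge :: "'a::euclidean_space \<Rightarrow> 'a \<Rightarrow> 'a endo" where
  "wedge a b = Blinfun (\<lambda>v. (a \<bullet> v) *\<^sub>R b - (b \<bullet> v) *\<^sub>R a)"

lemma wedge_apply [simp]: "blinfun_apply (wedge a b) v = (a \<bullet> v) *\<^sub>R b - (b \<bullet> v) *\<^sub>R a"
  unfolding wedge_def
  by (subst bounded_linear_Blinfun_apply) (auto intro!: bounded_linear_intros)

text \<open>On an orthonormal frame, identified with the quaternions \<open>1, i, j, k\<close>, this is left multiplication
  by \<open>w$1 i + w$2 j + w$3 k\<close>. Replacing \<open>e0\<close> by \<open>- e0\<close> turns it into right multiplication by the
  conjugate, so that both ideals of so(4) are instances of the same definition.\<close>

definition self_dual :: "'a::euclidean_space \<Rightarrow> 'a \<Rightarrow> 'a \<Rightarrow> 'a \<Rightarrow> real^3 \<Rightarrow> 'a endo" where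
  "self_dual e0 e1 e2 e3 w =
     w$1 *\<^sub>R (wedge e0 e1 + wedge e2 e3) +
     w$2 *\<^sub>R (wedge e0 e2 + wedge e3 e1) +
     w$3 *\<^sub>R (wedge e0 e3 + wedge e1 e2)"

lemma linear_self_dual: "linear (self_dual e0 e1 e2 e3)"
  by (rule linearI) (simp_all add: self_dual_def algebra_simps)

lemma so_wedge: "wedge a b \<in> so"
  by (simp add: so_def inner_diff_left inner_diff_right inner_commute)

lemma subspace_so: "subspace so"
  by (auto simp: subspace_def so_def blinfun.add_left blinfun.scaleR_left blinfun.zero_left
      inner_add_left inner_add_right)

lemma self_dual_so: "self_dual e0 e1 e2 e3 w \<in> so"
  unfolding self_dual_def
  by (intro subspace_add subspace_scale subspace_so so_wedge)

section \<open>Euclidean 3-space: skew operators as cross products\<close>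

definition cross_endo :: "real^3 \<Rightarrow> (real^3) endo" where
  "cross_endo w = Blinfun (\<lambda>v. cross3 w v)"

lemma cross_endo_apply [simp]: "blinfun_apply (cross_endo w) v = cross3 w v"
  unfolding cross_endo_def
  by (subst bounded_linear_Blinfun_apply)
    (auto intro!: linear_conv_bounded_linear[THEN iffD1] linearI simp: cross_add_right cross_mult_right)

lemma linear_cross_endo: "linear cross_endo"
  by (rule linearI; rule blinfun_eqI)
    (simp_all add: blinfun.add_left blinfun.scaleR_left cross_add_left cross_mult_left)

lemma inj_cross_endo: "inj cross_endo"
proof (rule injI)
  fix u v :: "real^3"
  assume "cross_endo u = cross_endo v"
  then have eq: "cross3 u x = cross3 v x" for x
    by (metis cross_endo_apply)
  \<comment> \<open>The product with \<open>axis 1 1\<close> shows the second and third coordinates,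
    the one with \<open>axis 2 1\<close> the first and third.\<close>
  show "u = v"
    using eq[of "axis 1 1"] eq[of "axis 2 1"]
    by (simp add: cross3_def vec_eq_iff forall_3 axis_def)
qed

lemma range_cross_endo: "range cross_endo = so"
proof (intro equalityI subsetI)
  fix A assume "A \<in> range cross_endo"
  then obtain w where "A = cross_endo w" by blast
  then show "A \<in> so"
    by (simp add: so_def cross3_def inner_vec_def sum_3 algebra_simps)
next
  fix A :: "(real^3) endo"
  assume A: "A \<in> so"
  \<comment> \<open>\<open>a i j\<close> is the matrix entry in row \<open>i\<close> and column
    \<open>j\<close>. Skewness leaves three free entries, and \<open>a 3 2\<close>,
    \<open>a 1 3\<close>, \<open>a 2 1\<close> are the coordinates of the axis vector.\<close>
  define a where "a i j = blinfun_apply A (axis j 1) $ i" for i j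
  have skew: "a i j = - a j i" for i j
  proof -
    have "inner (blinfun_apply A (axis j 1)) (axis i 1) = - inner (axis j 1) (blinfun_apply A (axis i 1))"
      using A by (simp add: so_def)
    then show ?thesis by (simp add: a_def inner_axis inner_axis')
  qed
  have diag: "a i i = 0" for i using skew[of i i] by simp
  have "A = cross_endo (vector [a 3 2, a 1 3, a 2 1])"
  proof (rule blinfun_eqI)
    fix v :: "real^3"
    have v: "v = v$1 *\<^sub>R axis 1 1 + v$2 *\<^sub>R axis 2 1 + v$3 *\<^sub>R axis 3 1"
      by (simp add: vec_eq_iff forall_3 axis_def)
    have "blinfun_apply A v = v$1 *\<^sub>R blinfun_apply A (axis 1 1) +
        v$2 *\<^sub>R blinfun_apply A (axis 2 1) + v$3 *\<^sub>R blinfun_apply A (axis 3 1)"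
      by (subst arg_cong[OF v, of "blinfun_apply A"]) (simp add: blinfun.add_right blinfun.scaleR_right)
    then have "blinfun_apply A v $ i = v$1 * a i 1 + v$2 * a i 2 + v$3 * a i 3" for i
      by (simp add: a_def)
    then show "blinfun_apply A v = blinfun_apply (cross_endo (vector [a 3 2, a 1 3, a 2 1])) v"
      using skew[of 1 2] skew[of 1 3] skew[of 2 3]
      by (simp add: vec_eq_iff forall_3 cross3_def diag algebra_simps)
  qed
  then show "A \<in> range cross_endo" by blast
qed

lemma lie_bracket_cross_endo:
  "lie_bracket (cross_endo u) (cross_endo v) = cross_endo (cross3 u v)"
  by (rule blinfun_eqI)
    (simp add: lie_bracket_def blinfun.diff_left cross3_def vec_eq_iff forall_3 algebra_simps)

section \<open>Orthonormal quadruples as quaternion units and the splitting of so(4)\<close>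

locale frame4 =
  fixes e0 e1 e2 e3 :: "'a::euclidean_space"
  assumes unit: "e0 \<bullet> e0 = 1" "e1 \<bullet> e1 = 1" "e2 \<bullet> e2 = 1" "e3 \<bullet> e3 = 1"
    and orth: "e0 \<bullet> e1 = 0" "e0 \<bullet> e2 = 0" "e0 \<bullet> e3 = 0" "e1 \<bullet> e2 = 0" "e1 \<bullet> e3 = 0" "e2 \<bullet> e3 = 0"
begin

lemma orth':
  "e1 \<bullet> e0 = 0" "e2 \<bullet> e0 = 0" "e3 \<bullet> e0 = 0" "e2 \<bullet> e1 = 0" "e3 \<bullet> e1 = 0" "e3 \<bullet> e2 = 0"
  using orth by (simp_all add: inner_commute)

lemmas frame = unit orth orth'

abbreviation space :: "'a set" where "space \<equiv> span {e0, e1, e2, e3}"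

text \<open>Together with \<open>space_flip\<close> this transfers every result on \<open>sd\<close>
  to \<open>asd\<close>, on the same space.\<close>

lemma frame4_flip: "frame4 (- e0) e1 e2 e3"
  by unfold_locales (simp_all add: frame)

lemma space_flip: "span {- e0, e1, e2, e3} = space"
proof -
  have "- e0 \<in> space" "e0 \<in> span {- e0, e1, e2, e3}"
    by (metis insertI1 span_base span_neg minus_minus)+
  then show ?thesis
    by (intro span_eq[THEN iffD2]) (auto intro: span_base)
qed

lemma dim_space: "dim space = 4"
proof -
  have d: "e0 \<noteq> e1" "e0 \<noteq> e2" "e0 \<noteq> e3" "e1 \<noteq> e2" "e1 \<noteq> e3" "e2 \<noteq> e3"
    using unit orth by auto
  have "independent {e0, e1, e2, e3}"
    by (rule pairwise_orthogonal_independent)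
      (use frame in \<open>auto simp: pairwise_def orthogonal_def\<close>)
  then have "dim space = card {e0, e1, e2, e3}"
    by (rule dim_span_eq_card_independent)
  also have "\<dots> = 4" using d by simp
  finally show ?thesis .
qed

lemma comp_iff: "v \<in> space\<^sup>\<bottom> \<longleftrightarrow> e0 \<bullet> v = 0 \<and> e1 \<bullet> v = 0 \<and> e2 \<bullet> v = 0 \<and> e3 \<bullet> v = 0"
proof -
  have "(\<forall>y\<in>space. orthogonal v y) \<longleftrightarrow> (\<forall>y\<in>{e0, e1, e2, e3}. orthogonal v y)"
    using orthogonal_to_span[of _ "{e0, e1, e2, e3}" v] span_superset[of "{e0, e1, e2, e3}"] by fast
  then show ?thesis
    by (simp add: orthogonal_comp_def orthogonal_def inner_commute)
qed

definition rest :: "'a \<Rightarrow> 'a" where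
  "rest v = v - ((e0 \<bullet> v) *\<^sub>R e0 + (e1 \<bullet> v) *\<^sub>R e1 + (e2 \<bullet> v) *\<^sub>R e2 + (e3 \<bullet> v) *\<^sub>R e3)"

lemma rest_comp: "rest v \<in> space\<^sup>\<bottom>"
  by (simp add: comp_iff rest_def inner_diff_right inner_add_right frame)

lemma expand: "v = (e0 \<bullet> v) *\<^sub>R e0 + (e1 \<bullet> v) *\<^sub>R e1 + (e2 \<bullet> v) *\<^sub>R e2 + (e3 \<bullet> v) *\<^sub>R e3 + rest v"
  by (simp add: rest_def)

lemma rest_0: "v \<in> space \<Longrightarrow> rest v = 0"
proof -
  assume v: "v \<in> space"
  have "rest v \<in> space"
    unfolding rest_def by (intro span_diff span_add span_scale v span_base) auto
  then have "orthogonal (rest v) (rest v)"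
    using rest_comp[of v] by (auto simp: orthogonal_comp_def)
  then show ?thesis by (simp add: orthogonal_def)
qed

lemma endo_expand:
  fixes T :: "'a endo"
  shows "blinfun_apply T v = (e0 \<bullet> v) *\<^sub>R blinfun_apply T e0 + (e1 \<bullet> v) *\<^sub>R blinfun_apply T e1 +
    (e2 \<bullet> v) *\<^sub>R blinfun_apply T e2 + (e3 \<bullet> v) *\<^sub>R blinfun_apply T e3 + blinfun_apply T (rest v)"
  by (subst arg_cong[OF expand, of "blinfun_apply T" v]) (simp add: blinfun.add_right blinfun.scaleR_right)

lemma endo_eq_on_space:
  assumes "v \<in> space"
    and "blinfun_apply A e0 = blinfun_apply B e0" "blinfun_apply A e1 = blinfun_apply B e1"
    and "blinfun_apply A e2 = blinfun_apply B e2" "blinfun_apply A e3 = blinfun_apply (B :: 'a endo) e3"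
  shows "blinfun_apply A v = blinfun_apply B v"
  unfolding endo_expand[of A v] endo_expand[of B v] rest_0[OF assms(1)] assms(2-)
  by (simp add: blinfun.zero_right)

lemma endo_eqI:
  assumes "\<And>v. v \<in> space\<^sup>\<bottom> \<Longrightarrow> blinfun_apply A v = blinfun_apply B v"
    and "blinfun_apply A e0 = blinfun_apply B e0" "blinfun_apply A e1 = blinfun_apply B e1"
    and "blinfun_apply A e2 = blinfun_apply B e2" "blinfun_apply A e3 = blinfun_apply B e3"
  shows "A = (B :: 'a endo)"
proof (rule blinfun_eqI)
  fix v
  show "blinfun_apply A v = blinfun_apply B v"
    unfolding endo_expand[of A v] endo_expand[of B v] assms(1)[OF rest_comp[of v]] assms(2-) ..
qed

abbreviation sd :: "real^3 \<Rightarrow> 'a endo" where "sd \<equiv> self_dual e0 e1 e2 e3"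
abbreviation asd :: "real^3 \<Rightarrow> 'a endo" where "asd \<equiv> self_dual (- e0) e1 e2 e3"

lemma sd_comp: "v \<in> space\<^sup>\<bottom> \<Longrightarrow> blinfun_apply (sd w) v = 0"
  by (simp add: comp_iff self_dual_def blinfun.add_left blinfun.scaleR_left)

lemma asd_comp: "v \<in> space\<^sup>\<bottom> \<Longrightarrow> blinfun_apply (asd w) v = 0"
  by (simp add: comp_iff self_dual_def blinfun.add_left blinfun.scaleR_left)

lemma sd_frame:
  "blinfun_apply (sd w) e0 = w$1 *\<^sub>R e1 + w$2 *\<^sub>R e2 + w$3 *\<^sub>R e3"
  "blinfun_apply (sd w) e1 = - (w$1) *\<^sub>R e0 + w$3 *\<^sub>R e2 - (w$2) *\<^sub>R e3"
  "blinfun_apply (sd w) e2 = - (w$2) *\<^sub>R e0 - (w$3) *\<^sub>R e1 + w$1 *\<^sub>R e3"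
  "blinfun_apply (sd w) e3 = - (w$3) *\<^sub>R e0 + w$2 *\<^sub>R e1 - (w$1) *\<^sub>R e2"
  by (simp_all add: self_dual_def blinfun.add_left blinfun.scaleR_left frame)

lemma asd_frame:
  "blinfun_apply (asd w) e0 = - (w$1) *\<^sub>R e1 - (w$2) *\<^sub>R e2 - (w$3) *\<^sub>R e3"
  "blinfun_apply (asd w) e1 = w$1 *\<^sub>R e0 + w$3 *\<^sub>R e2 - (w$2) *\<^sub>R e3"
  "blinfun_apply (asd w) e2 = w$2 *\<^sub>R e0 - (w$3) *\<^sub>R e1 + w$1 *\<^sub>R e3"
  "blinfun_apply (asd w) e3 = w$3 *\<^sub>R e0 + w$2 *\<^sub>R e1 - (w$1) *\<^sub>R e2"
  by (simp_all add: self_dual_def blinfun.add_left blinfun.scaleR_left frame)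

lemma sd_so_on: "sd w \<in> so_on space"
  by (simp add: so_on_def self_dual_so sd_comp)

lemma inj_sd: "inj sd"
proof (rule injI)
  fix u v assume "sd u = sd v"
  then have "blinfun_apply (sd u) e0 \<bullet> x = blinfun_apply (sd v) e0 \<bullet> x" for x by simp
  from this[of e1] this[of e2] this[of e3] show "u = v"
    by (simp add: sd_frame inner_add_left frame vec_eq_iff forall_3)
qed

lemmas endo_apply_simps = blinfun.diff_left blinfun.add_left blinfun.scaleR_left blinfun.zero_left
  blinfun.zero_right blinfun.add_right blinfun.diff_right blinfun.scaleR_right blinfun.minus_right

text \<open>Left multiplications compose like quaternions, and imaginary quaternions satisfy
  \<open>u v - v u = 2 (u \<times> v)\<close>.\<close>

lemma lie_bracket_sd: "lie_bracket (sd u) (sd v) = sd (2 *\<^sub>R cross3 u v)"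
proof (rule endo_eqI)
  fix x assume "x \<in> space\<^sup>\<bottom>"
  then show "blinfun_apply (lie_bracket (sd u) (sd v)) x = blinfun_apply (sd (2 *\<^sub>R cross3 u v)) x"
    by (simp add: lie_bracket_def endo_apply_simps sd_comp)
\<comment> \<open>On the frame vectors both sides are compared through inner products, which leaves
  ring identities.\<close>
qed (rule vector_eq_ldot[THEN iffD1, rule_format],
  simp add: lie_bracket_def endo_apply_simps sd_frame cross3_def inner_simps algebra_simps)+

text \<open>Left and right multiplications commute because the quaternions are associative.\<close>

lemma lie_bracket_sd_asd: "lie_bracket (sd u) (asd v) = 0"
proof (rule endo_eqI)
  fix x assume "x \<in> space\<^sup>\<bottom>"
  then show "blinfun_apply (lie_bracket (sd u) (asd v)) x = blinfun_apply 0 x"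
    by (simp add: lie_bracket_def endo_apply_simps sd_comp asd_comp)
qed (rule vector_eq_ldot[THEN iffD1, rule_format],
  simp add: lie_bracket_def endo_apply_simps sd_frame asd_frame inner_simps algebra_simps)+

lemma asd_so_on: "asd w \<in> so_on space"
  using frame4.sd_so_on[OF frame4_flip, of w] by (simp add: space_flip)

text \<open>Skewness moves \<open>A\<close> onto vectors of the complement, where it vanishes; so
  the image lies in the double complement.\<close>

lemma so_on_maps_into:
  assumes "A \<in> so_on space"
  shows "blinfun_apply A v \<in> space"
proof -
  have "inner w (blinfun_apply A v) = 0" if "w \<in> space\<^sup>\<bottom>" for w
  proof -
    have "inner (blinfun_apply A w) v = - inner w (blinfun_apply A v)" "blinfun_apply A w = 0"
      using assms that unfolding so_on_def so_def by blast+
    then show ?thesis by simp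
  qed
  then have "blinfun_apply A v \<in> (space\<^sup>\<bottom>)\<^sup>\<bottom>"
    by (simp add: orthogonal_comp_def[of "space\<^sup>\<bottom>"] orthogonal_def)
  then show ?thesis by (simp add: orthogonal_comp_self)
qed

lemma so_on_decompose:
  assumes A: "A \<in> so_on space"
  shows "\<exists>u v. A = sd u + asd v"
proof -
  define a where "a x y = y \<bullet> blinfun_apply A x" for x y
  have skew: "a y x = - a x y" for x y
  proof -
    have "blinfun_apply A x \<bullet> y = - (x \<bullet> blinfun_apply A y)"
      using A unfolding so_on_def so_def by blast
    then show ?thesis by (simp add: a_def inner_commute)
  qed
  have diag: "a x x = 0" for x using skew[of x x] by simp
  have im: "blinfun_apply A x = a x e0 *\<^sub>R e0 + a x e1 *\<^sub>R e1 + a x e2 *\<^sub>R e2 + a x e3 *\<^sub>R e3" for x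
    by (subst expand) (simp add: a_def rest_0[OF so_on_maps_into[OF A]])
  \<comment> \<open>The coefficients of \<open>sd u + asd v\<close> are \<open>u - v\<close> for the
    pairs 01, 02, 03 and \<open>u + v\<close> for the opposite pairs 23, 31, 12; half sums and half
    differences solve this system.\<close>
  define u :: "real^3" where "u = vector [(a e0 e1 + a e2 e3) / 2, (a e0 e2 + a e3 e1) / 2, (a e0 e3 + a e1 e2) / 2]"
  define v :: "real^3" where "v = vector [(a e2 e3 - a e0 e1) / 2, (a e3 e1 - a e0 e2) / 2, (a e1 e2 - a e0 e3) / 2]"
  have uv: "u$1 - v$1 = a e0 e1" "u$2 - v$2 = a e0 e2" "u$3 - v$3 = a e0 e3"
    "u$1 + v$1 = a e2 e3" "u$2 + v$2 = a e3 e1" "u$3 + v$3 = a e1 e2"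
    by (simp_all add: u_def v_def field_simps)
  have "A = sd u + asd v"
  proof (rule endo_eqI)
    fix x assume x: "x \<in> space\<^sup>\<bottom>"
    then have "blinfun_apply A x = 0" using A by (simp add: so_on_def)
    with x show "blinfun_apply A x = blinfun_apply (sd u + asd v) x"
      by (simp add: blinfun.add_left sd_comp asd_comp)
  qed (simp_all add: blinfun.add_left sd_frame asd_frame im diag skew[of e1 e0] skew[of e2 e0]
      skew[of e3 e0] skew[of e2 e1] skew[of e1 e3] skew[of e3 e2] algebra_simps flip: uv)
  then show ?thesis by blast
qed

lemma sd_asd_disjoint: "range sd \<inter> range asd = {0}"
proof -
  have "sd u = 0" if eq: "sd u = asd v" for u v
  proof -
    have "blinfun_apply (sd u) x \<bullet> y = blinfun_apply (asd v) x \<bullet> y" for x y using eq by simp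
    \<comment> \<open>In each two consecutive instances, \<open>sd\<close> has equal coefficients
      and \<open>asd\<close> opposite ones, so a common element has both equal to zero.\<close>
    from this[of e0 e1] this[of e2 e3] this[of e0 e2] this[of e3 e1] this[of e0 e3] this[of e1 e2]
    have "u = 0"
      by (simp add: sd_frame asd_frame inner_simps frame vec_eq_iff forall_3)
    then show ?thesis
      by (simp add: linear_0[OF linear_self_dual])
  qed
  moreover have "0 \<in> range sd" "0 \<in> range asd"
    by (metis linear_0[OF linear_self_dual] rangeI)+
  ultimately show ?thesis by auto
qed

lemma lie_ideal_sd: "lie_ideal (range sd) (so_on space)"
  unfolding lie_ideal_def
proof (intro conjI ballI)
  show "subspace (range sd)"
    by (rule linear_subspace_image[OF linear_self_dual subspace_UNIV])
  show "range sd \<subseteq> so_on space" using sd_so_on by blast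
  fix A B assume "A \<in> so_on space" "B \<in> range sd"
  then obtain u v w where "A = sd u + asd v" "B = sd w"
    using so_on_decompose by blast
  \<comment> \<open>The \<open>asd\<close> part of \<open>A\<close> contributes nothing, and the
    \<open>sd\<close> part brackets \<open>B\<close> back into \<open>range sd\<close>.\<close>
  then have "lie_bracket A B = lie_bracket (sd u) (sd w) - lie_bracket (sd w) (asd v)"
    by (simp add: lie_bracket_def bounded_bilinear.add_left[OF bounded_bilinear_blinfun_compose]
        bounded_bilinear.add_right[OF bounded_bilinear_blinfun_compose])
  then show "lie_bracket A B \<in> range sd"
    by (simp add: lie_bracket_sd lie_bracket_sd_asd)
qed

lemma lie_isomorphic_sd: "lie_isomorphic (range sd) (so :: (real^3) endo set)"
proof -
  \<comment> \<open>Doubling absorbs the factor 2 in \<open>lie_bracket_sd\<close>: both sides of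
    the bracket identity become the cross product with \<open>4 (u \<times> v)\<close>.\<close>
  define f where "f w = cross_endo (2 *\<^sub>R w)" for w
  define \<phi> where "\<phi> A = f (inv sd A)" for A
  have lin: "linear f"
    by (rule linearI) (simp_all add: f_def linear_add[OF linear_cross_endo]
        linear_scale[OF linear_cross_endo] scaleR_add_right)
  have \<phi>: "\<phi> (sd w) = f w" for w
    by (simp add: \<phi>_def inv_f_f[OF inj_sd])
  have "bij_betw f UNIV so"
    unfolding bij_betw_def
  proof
    show "inj f" by (rule injI) (use inj_cross_endo in \<open>simp add: f_def inj_eq\<close>)
    show "range f = so"
      unfolding range_cross_endo[symmetric]
    proof safe
      fix w show "f w \<in> range cross_endo" by (simp add: f_def)
      have "cross_endo w = f ((1/2) *\<^sub>R w)" by (simp add: f_def)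
      then show "cross_endo w \<in> range f" by blast
    qed
  qed
  then have "bij_betw \<phi> (range sd) so"
    unfolding \<phi>_def using bij_betw_trans[OF inj_imp_bij_betw_inv[OF inj_sd]] by (simp add: o_def)
  moreover have "\<phi> (A + B) = \<phi> A + \<phi> B" if AB: "A \<in> range sd" "B \<in> range sd" for A B
  proof -
    from AB obtain u v where "A = sd u" "B = sd v" by blast
    then show ?thesis
      using \<phi>[of "u + v"] by (simp add: \<phi> linear_add[OF linear_self_dual] linear_add[OF lin])
  qed
  moreover have "\<phi> (c *\<^sub>R A) = c *\<^sub>R \<phi> A" if A: "A \<in> range sd" for A c
  proof -
    from A obtain u where "A = sd u" by blast
    then show ?thesis
      using \<phi>[of "c *\<^sub>R u"] by (simp add: \<phi> linear_scale[OF linear_self_dual] linear_scale[OF lin])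
  qed
  moreover have "\<phi> (lie_bracket A B) = lie_bracket (\<phi> A) (\<phi> B)"
    if AB: "A \<in> range sd" "B \<in> range sd" for A B
  proof -
    from AB obtain u v where "A = sd u" "B = sd v" by blast
    then show ?thesis
      by (simp add: lie_bracket_sd \<phi> f_def lie_bracket_cross_endo cross_mult_left cross_mult_right)
  qed
  ultimately show ?thesis
    unfolding lie_isomorphic_def by blast
qed

lemma so3_ideal_sd: "so3_ideal_of_so4 (range sd) space"
proof -
  \<comment> \<open>The complementary ideal is \<open>range asd\<close>, which is the
    \<open>sd\<close> ideal of the flipped frame.\<close>
  interpret flip: frame4 "- e0" e1 e2 e3 by (rule frame4_flip)
  have "lie_ideal (range asd) (so_on space)"
    using flip.lie_ideal_sd by (simp add: space_flip)
  moreover have "so_on space = {A + B |A B. A \<in> range sd \<and> B \<in> range asd}"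
  proof (intro equalityI subsetI)
    fix A assume "A \<in> so_on space"
    then show "A \<in> {A + B |A B. A \<in> range sd \<and> B \<in> range asd}"
      using so_on_decompose by blast
  next
    fix C assume "C \<in> {A + B |A B. A \<in> range sd \<and> B \<in> range asd}"
    then obtain u v where "C = sd u + asd v" by blast
    then show "C \<in> so_on space"
      using sd_so_on[of u] asd_so_on[of v] subspace_add[OF subspace_so]
      by (auto simp: so_on_def blinfun.add_left)
  qed
  ultimately show ?thesis
    unfolding so3_ideal_of_so4_def
    using lie_ideal_sd lie_isomorphic_sd flip.lie_isomorphic_sd sd_asd_disjoint by blast
qed

end

section \<open>Irreducible subspaces\<close>

text \<open>The eigenvector maximises the Rayleigh quotient over the unit sphere of \<open>W\<close>.\<close>

lemma symmetric_on_subspace_eigenvector: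
  fixes T :: "'a::euclidean_space \<Rightarrow> 'a"
  assumes T: "linear T" and W: "subspace W" "W \<noteq> {0}"
    and TW: "\<And>w. w \<in> W \<Longrightarrow> T w \<in> W"
    and sym: "\<And>v w. v \<in> W \<Longrightarrow> w \<in> W \<Longrightarrow> T v \<bullet> w = v \<bullet> T w"
  obtains c w where "w \<in> W" "w \<noteq> 0" "T w = c *\<^sub>R w"
proof -
  let ?S = "W \<inter> sphere 0 1"
  have unit: "(1 / norm v) *\<^sub>R v \<in> ?S" if "v \<in> W" "v \<noteq> 0" for v
    using that W by (simp add: subspace_scale)
  have "compact ?S"
    by (simp add: closed_Int_compact closed_subspace W)
  moreover have "?S \<noteq> {}"
    using W unit subspace_0 by blast
  moreover have "continuous_on ?S (\<lambda>w. T w \<bullet> w)"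
    using T by (intro continuous_intros linear_continuous_on) (simp add: linear_conv_bounded_linear)
  ultimately obtain w where w: "w \<in> ?S" and max: "\<And>v. v \<in> ?S \<Longrightarrow> T v \<bullet> v \<le> T w \<bullet> w"
    using continuous_attains_sup[of ?S "\<lambda>w. T w \<bullet> w"] by blast
  define c where "c = T w \<bullet> w"
  have wW: "w \<in> W" and ww: "w \<bullet> w = 1" using w by (auto simp: dot_square_norm)
  have le: "T v \<bullet> v \<le> c * (v \<bullet> v)" if "v \<in> W" for v
  proof (cases "v = 0")
    case False
    have "T ((1 / norm v) *\<^sub>R v) \<bullet> ((1 / norm v) *\<^sub>R v) \<le> c"
      using max[OF unit[OF that False]] by (simp add: c_def)
    then show ?thesis
      using False by (simp add: linear_scale[OF T] field_simps dot_square_norm power2_eq_square)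
  qed (simp add: linear_0[OF T])
  \<comment> \<open>\<open>u\<close> is the defect of the eigenvector equation and serves as the
    direction of variation: \<open>c * (v \<bullet> v) - T v \<bullet> v\<close> is nonnegative on
    \<open>W\<close>, vanishes at \<open>w\<close>, and equals
    \<open>2 * t * \<beta> + t\<^sup>2 * \<gamma>\<close> at
    \<open>w + t *\<^sub>R u\<close>.\<close>
  define u where "u = c *\<^sub>R w - T w"
  have uW: "u \<in> W" unfolding u_def using wW W TW by (intro subspace_diff subspace_scale)
  define \<beta> where "\<beta> = u \<bullet> u"
  define \<gamma> where "\<gamma> = c * (u \<bullet> u) - T u \<bullet> u"
  have \<gamma>: "\<gamma> \<ge> 0" using le[OF uW] by (simp add: \<gamma>_def)
  have "2 * t * \<beta> + t\<^sup>2 * \<gamma> \<ge> 0" for t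
  proof -
    have "T (w + t *\<^sub>R u) \<bullet> (w + t *\<^sub>R u) \<le> c * ((w + t *\<^sub>R u) \<bullet> (w + t *\<^sub>R u))"
      by (intro le subspace_add subspace_scale W wW uW)
    moreover have "T u \<bullet> w = T w \<bullet> u" using sym[OF uW wW] by (simp add: inner_commute)
    moreover have \<beta>: "\<beta> = c * (w \<bullet> u) - T w \<bullet> u"
      by (simp add: \<beta>_def u_def[symmetric] inner_diff_left[symmetric] flip: inner_scaleR_left)
    moreover have "t * \<beta> = t * (c * (w \<bullet> u)) - t * (T w \<bullet> u)"
      using \<beta> by (simp add: right_diff_distrib)
    ultimately show ?thesis
      by (simp add: linear_add[OF T] linear_scale[OF T] inner_simps c_def[symmetric] ww \<gamma>_def
          inner_commute[of u w] power2_eq_square algebra_simps)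
  qed
  note quad = this
  \<comment> \<open>The step \<open>t = - \<beta> * r\<close> is short enough for the linear term to
    dominate, which forces \<open>\<beta> = 0\<close>. Adding 1 to \<open>\<gamma>\<close> keeps the
    denominator positive.\<close>
  define r where "r = 1 / (\<gamma> + 1)"
  have r: "r > 0" "r * \<gamma> < 1" using \<gamma> by (simp_all add: r_def)
  have "2 * (- \<beta> * r) * \<beta> + (- \<beta> * r)\<^sup>2 * \<gamma> = - (\<beta>\<^sup>2 * (r * (2 - r * \<gamma>)))"
    by (simp add: power2_eq_square algebra_simps)
  with quad[of "- \<beta> * r"] have "\<beta>\<^sup>2 * (r * (2 - r * \<gamma>)) \<le> 0" by simp
  moreover have "r * (2 - r * \<gamma>) > 0" using r by simp
  ultimately have "\<beta> = 0"
    by (smt (verit) mult_pos_pos zero_less_power2)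
  then have "T w = c *\<^sub>R w" by (simp add: \<beta>_def u_def)
  moreover have "w \<noteq> 0" using ww by auto
  ultimately show ?thesis using wW that by blast
qed


lemma orthogonal_projection_exists:
  fixes W :: "'a::euclidean_space set"
  assumes W: "subspace W"
  obtains P where "linear P" "\<And>v. P v \<in> W" "\<And>v w. w \<in> W \<Longrightarrow> (v - P v) \<bullet> w = 0"
proof -
  obtain B where B: "B \<subseteq> W" "pairwise orthogonal B" "\<And>x. x \<in> B \<Longrightarrow> norm x = 1"
    "independent B" "span B = W"
    using orthonormal_basis_subspace[OF W] by metis
  have fin: "finite B" using B(4) by (rule independent_imp_finite)
  define P where "P v = (\<Sum>b\<in>B. (v \<bullet> b) *\<^sub>R b)" for v
  show ?thesis
  proof
    show "linear P"
      by (rule linearI) (simp_all add: P_def inner_add_left scaleR_add_left sum.distrib scaleR_sum_right)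
    show "P v \<in> W" for v
      unfolding P_def using B(1) W by (intro subspace_sum subspace_scale) auto
    fix v w assume "w \<in> W"
    have "orthogonal (v - P v) b" if b: "b \<in> B" for b
    proof -
      have "P v \<bullet> b = (\<Sum>c\<in>B. if c = b then v \<bullet> b else 0)"
        unfolding P_def inner_sum_left
        by (rule sum.cong) (use B(2,3) b in \<open>auto simp: pairwise_def orthogonal_def dot_square_norm\<close>)
      then show ?thesis
        using fin b by (simp add: orthogonal_def inner_diff_left)
    qed
    then have "orthogonal (v - P v) w"
      using orthogonal_to_span[of w B] \<open>w \<in> W\<close> B(5) by blast
    then show "(v - P v) \<bullet> w = 0" by (simp add: orthogonal_def)
  qed
qed

text \<open>Non-singularity is stated as triviality of kernels, so that evaluation at any nonzero
  vector is injective on \<open>V\<close>.\<close>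

locale nonsingular_centralizer_type =
  fixes V :: "'a::euclidean_space endo set"
  assumes subspace_V: "subspace V"
    and V_so: "V \<subseteq> so"
    and nonsing: "\<And>J x. J \<in> V \<Longrightarrow> J \<noteq> 0 \<Longrightarrow> blinfun_apply J x = 0 \<Longrightarrow> x = 0"
    and cent: "\<And>J x. J \<in> V \<Longrightarrow> \<exists>N\<in>so_centralizer V. blinfun_apply N x = blinfun_apply J x"
begin

lemma skew: "J \<in> V \<Longrightarrow> blinfun_apply J x \<bullet> y = - (x \<bullet> blinfun_apply J y)"
  using V_so unfolding so_def by blast

definition invariant :: "'a set \<Rightarrow> bool" where
  "invariant S \<longleftrightarrow> subspace S \<and> (\<forall>J\<in>V. \<forall>v\<in>S. blinfun_apply J v \<in> S)"

definition irreducible_sub :: "'a set \<Rightarrow> bool" where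
  "irreducible_sub W \<longleftrightarrow> invariant W \<and> W \<noteq> {0} \<and>
     (\<forall>S. invariant S \<and> S \<subseteq> W \<and> S \<noteq> {0} \<longrightarrow> S = W)"

lemma irreducible_sub_exists:
  assumes "invariant S" "S \<noteq> {0}"
  obtains W where "W \<subseteq> S" "irreducible_sub W"
proof -
  let ?Q = "\<lambda>W. invariant W \<and> W \<noteq> {0} \<and> W \<subseteq> S"
  obtain W where W: "?Q W" and least: "\<And>T. ?Q T \<Longrightarrow> dim W \<le> dim T"
    using ex_has_least_nat[of ?Q S dim] assms by auto
  have "T = W" if "invariant T" "T \<subseteq> W" "T \<noteq> {0}" for T
  proof (rule subspace_dim_equal)
    show "dim W \<le> dim T" using that W least[of T] by blast
  qed (use that W in \<open>auto simp: invariant_def\<close>)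
  with W that show ?thesis unfolding irreducible_sub_def by blast
qed

text \<open>A form of Schur's lemma: an eigenspace of \<open>T\<close> in \<open>W\<close> is a
  nonzero invariant subspace, hence all of \<open>W\<close>.\<close>

lemma symmetric_scalar:
  assumes W: "irreducible_sub W" and T: "linear T" "\<And>w. w \<in> W \<Longrightarrow> T w \<in> W"
    and sym: "\<And>v w. v \<in> W \<Longrightarrow> w \<in> W \<Longrightarrow> T v \<bullet> w = v \<bullet> T w"
    and comm: "\<And>J w. J \<in> V \<Longrightarrow> w \<in> W \<Longrightarrow> T (blinfun_apply J w) = blinfun_apply J (T w)"
  shows "\<exists>c. \<forall>w\<in>W. T w = c *\<^sub>R w"
proof -
  have sub: "subspace W" and inv: "\<And>J v. J \<in> V \<Longrightarrow> v \<in> W \<Longrightarrow> blinfun_apply J v \<in> W" and nz: "W \<noteq> {0}"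
    using W by (auto simp: irreducible_sub_def invariant_def)
  obtain c w where w: "w \<in> W" "w \<noteq> 0" "T w = c *\<^sub>R w"
    using symmetric_on_subspace_eigenvector[OF T(1) sub nz T(2) sym] by blast
  define E where "E = {v \<in> W. T v = c *\<^sub>R v}"
  have "subspace E"
    unfolding subspace_def E_def using sub
    by (auto simp: linear_0[OF T(1)] linear_add[OF T(1)] linear_scale[OF T(1)] subspace_0
        subspace_add subspace_scale scaleR_add_right)
  moreover have "blinfun_apply J v \<in> E" if "J \<in> V" "v \<in> E" for J v
    using that inv comm by (simp add: E_def blinfun.scaleR_right)
  ultimately have "invariant E" by (simp add: invariant_def)
  moreover have "E \<subseteq> W" "E \<noteq> {0}" using w by (auto simp: E_def)
  ultimately have "E = W" using W by (auto simp: irreducible_sub_def)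
  then show ?thesis by (auto simp: E_def)
qed

section \<open>Partners in the commutant and their Clifford relation\<close>

definition skew_commutant :: "'a set \<Rightarrow> ('a \<Rightarrow> 'a) \<Rightarrow> bool" where
  "skew_commutant W n \<longleftrightarrow> linear n \<and> (\<forall>w\<in>W. n w \<in> W) \<and>
     (\<forall>v\<in>W. \<forall>w\<in>W. n v \<bullet> w = - (v \<bullet> n w)) \<and>
     (\<forall>J\<in>V. \<forall>w\<in>W. n (blinfun_apply J w) = blinfun_apply J (n w))"

lemma skew_commutantD:
  assumes "skew_commutant W n"
  shows "linear n" "\<And>w. w \<in> W \<Longrightarrow> n w \<in> W" "\<And>v w. v \<in> W \<Longrightarrow> w \<in> W \<Longrightarrow> n v \<bullet> w = - (v \<bullet> n w)"
    "\<And>J w. J \<in> V \<Longrightarrow> w \<in> W \<Longrightarrow> n (blinfun_apply J w) = blinfun_apply J (n w)"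
  using assms unfolding skew_commutant_def by blast+

text \<open>The partner is the compression \<open>P \<circ> N\<close> of a centralizer element
  \<open>N\<close>, with \<open>P\<close> the orthogonal projection onto \<open>W\<close>. At
  \<open>x\<close> nothing is lost, since \<open>N x = J x\<close> already lies in
  \<open>W\<close>.\<close>

lemma skew_commutant_exists:
  assumes W: "invariant W" and J: "J \<in> V" and x: "x \<in> W"
  obtains n where "skew_commutant W n" "n x = blinfun_apply J x"
proof -
  have sub: "subspace W" and inv: "\<And>J v. J \<in> V \<Longrightarrow> v \<in> W \<Longrightarrow> blinfun_apply J v \<in> W"
    using W by (auto simp: invariant_def)
  obtain N where N: "N \<in> so_centralizer V" "blinfun_apply N x = blinfun_apply J x"
    using cent[OF J] by blast
  have Nskew: "blinfun_apply N v \<bullet> w = - (v \<bullet> blinfun_apply N w)" for v w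
    using N(1) unfolding so_centralizer_def so_def by blast
  have Ncomm: "blinfun_apply N (blinfun_apply K v) = blinfun_apply K (blinfun_apply N v)" if "K \<in> V" for K v
  proof -
    have "lie_bracket N K = 0" using N(1) that by (simp add: so_centralizer_def)
    then have "blinfun_apply (lie_bracket N K) v = 0" by simp
    then show ?thesis by (simp add: lie_bracket_def blinfun.diff_left)
  qed
  obtain P where P: "linear P" "\<And>v. P v \<in> W" "\<And>v w. w \<in> W \<Longrightarrow> (v - P v) \<bullet> w = 0"
    using orthogonal_projection_exists[OF sub] by blast
  \<comment> \<open>Uniqueness of the orthogonal projection, used to identify its values.\<close>
  have Peq: "P v = z" if z: "z \<in> W" "\<And>w. w \<in> W \<Longrightarrow> (v - z) \<bullet> w = 0" for v z
  proof -
    have m: "P v - z \<in> W" using P(2) z(1) sub by (intro subspace_diff)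
    have "(P v - z) \<bullet> (P v - z) = (v - z) \<bullet> (P v - z) - (v - P v) \<bullet> (P v - z)"
      by (simp add: inner_diff_left)
    then show ?thesis using z(2)[OF m] P(3)[OF m] by simp
  qed
  have Pin: "P v \<bullet> w = v \<bullet> w" if "w \<in> W" for v w
    using P(3)[OF that, of v] by (simp add: inner_diff_left)
  \<comment> \<open>\<open>P\<close> commutes with \<open>V\<close>: skewness moves \<open>K\<close>
    onto \<open>w\<close>, and \<open>K w\<close> stays in \<open>W\<close>, to which
    \<open>v - P v\<close> is orthogonal.\<close>
  have PJ: "P (blinfun_apply K v) = blinfun_apply K (P v)" if K: "K \<in> V" for K v
  proof (rule Peq)
    show "blinfun_apply K (P v) \<in> W" using inv[OF K] P(2) by blast
    fix w assume w: "w \<in> W"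
    have "(blinfun_apply K v - blinfun_apply K (P v)) \<bullet> w = - ((v - P v) \<bullet> blinfun_apply K w)"
      by (simp add: skew[OF K, of "v - P v", symmetric] blinfun.diff_right)
    then show "(blinfun_apply K v - blinfun_apply K (P v)) \<bullet> w = 0"
      using P(3)[OF inv[OF K w]] by simp
  qed
  define n where "n v = P (blinfun_apply N v)" for v
  have "linear n"
    by (rule linearI)
      (simp_all add: n_def blinfun.add_right blinfun.scaleR_right linear_add[OF P(1)] linear_scale[OF P(1)])
  moreover have "n v \<bullet> w = - (v \<bullet> n w)" if "v \<in> W" "w \<in> W" for v w
    using that Nskew[of v w] Pin[of w "blinfun_apply N v"] Pin[of v "blinfun_apply N w"]
    by (simp add: n_def inner_commute)
  moreover have "n (blinfun_apply K w) = blinfun_apply K (n w)" if "K \<in> V" for K w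
    by (simp add: n_def Ncomm[OF that] PJ[OF that])
  ultimately have "skew_commutant W n"
    unfolding skew_commutant_def using P(2) by (auto simp: n_def)
  moreover have "n x = blinfun_apply J x"
    unfolding n_def N(2) using inv[OF J x] by (intro Peq) auto
  ultimately show ?thesis using that by blast
qed

text \<open>The anticommutator of two skew maps is symmetric and here commutes with
  \<open>V\<close>, so \<open>symmetric_scalar\<close> makes it a scalar, whose value is read off at
  the unit vector \<open>x\<close>.\<close>

lemma skew_commutant_anticommutator:
  assumes W: "irreducible_sub W" and n: "skew_commutant W n" and m: "skew_commutant W m"
    and x: "x \<in> W" "x \<bullet> x = 1" and w: "w \<in> W"
  shows "n (m w) + m (n w) = (- 2 * (n x \<bullet> m x)) *\<^sub>R w"
proof -
  note n = skew_commutantD[OF n] and m = skew_commutantD[OF m]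
  have sub: "subspace W" and inv: "\<And>J v. J \<in> V \<Longrightarrow> v \<in> W \<Longrightarrow> blinfun_apply J v \<in> W"
    using W by (auto simp: irreducible_sub_def invariant_def)
  have "\<exists>c. \<forall>w\<in>W. n (m w) + m (n w) = c *\<^sub>R w"
  proof (rule symmetric_scalar[OF W])
    show "linear (\<lambda>w. n (m w) + m (n w))"
      using linear_compose_add[OF linear_compose[OF m(1) n(1)] linear_compose[OF n(1) m(1)]]
      by (simp add: o_def)
    show "n (m w) + m (n w) \<in> W" if "w \<in> W" for w
      using that n(2) m(2) sub by (intro subspace_add) auto
    show "(n (m v) + m (n v)) \<bullet> w = v \<bullet> (n (m w) + m (n w))" if "v \<in> W" "w \<in> W" for v w
      using that n(2,3) m(2,3) by (simp add: inner_add_left inner_add_right)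
    show "n (m (blinfun_apply J w)) + m (n (blinfun_apply J w)) = blinfun_apply J (n (m w) + m (n w))"
      if "J \<in> V" "w \<in> W" for J w
      using that n(2,4) m(2,4) by (simp add: blinfun.add_right)
  qed
  then obtain c where c: "\<And>w. w \<in> W \<Longrightarrow> n (m w) + m (n w) = c *\<^sub>R w" by blast
  have "c = (n (m x) + m (n x)) \<bullet> x" using c[OF x(1)] x(2) by simp
  also have "\<dots> = - 2 * (n x \<bullet> m x)"
    using n(3)[of "m x" x] m(3)[of "n x" x] n(2) m(2) x(1)
    by (simp add: inner_add_left inner_add_right inner_commute)
  finally show ?thesis using c[OF w] by simp
qed

lemma skew_commutant_scale:
  assumes "subspace W" "skew_commutant W n"
  shows "skew_commutant W (\<lambda>w. c *\<^sub>R n w)"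
  using assms skew_commutantD[OF assms(2)]
  by (auto simp: skew_commutant_def linear_compose_scale_right subspace_scale blinfun.scaleR_right)

lemma skew_commutant_diff:
  assumes "subspace W" "skew_commutant W n" "skew_commutant W m"
  shows "skew_commutant W (\<lambda>w. n w - m w)"
  using assms skew_commutantD[OF assms(2)] skew_commutantD[OF assms(3)]
  by (auto simp: skew_commutant_def linear_compose_sub subspace_diff blinfun.diff_right
      inner_diff_left inner_diff_right)

section \<open>The quaternionic frame of an irreducible subspace\<close>

lemma irreducible_sub_frame:
  assumes W: "irreducible_sub W" and J: "J1 \<in> V" "J2 \<in> V" "J1 \<noteq> 0" "J2 \<notin> span {J1}"
  shows "\<exists>e0 e1 e2 e3. frame4 e0 e1 e2 e3 \<and> W = span {e0, e1, e2, e3} \<and>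
    (\<forall>J\<in>V. \<exists>w. \<forall>v\<in>W. blinfun_apply J v = blinfun_apply (self_dual e0 e1 e2 e3 w) v)"
proof -
  have sub: "subspace W" and invar: "invariant W" and "W \<noteq> {0}"
    and inv: "\<And>J v. J \<in> V \<Longrightarrow> v \<in> W \<Longrightarrow> blinfun_apply J v \<in> W"
    using W by (auto simp: irreducible_sub_def invariant_def)
  then obtain y where y: "y \<in> W" "y \<noteq> 0" using subspace_0 by blast
  define x where "x = (1 / norm y) *\<^sub>R y"
  have x: "x \<in> W" "x \<bullet> x = 1" "x \<noteq> 0"
    using y sub by (auto simp: x_def subspace_scale dot_square_norm)
  have normalise: "\<exists>c. (c *\<^sub>R blinfun_apply J x) \<bullet> (c *\<^sub>R blinfun_apply J x) = 1" if "J \<in> V" "J \<noteq> 0" for J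
  proof -
    have "blinfun_apply J x \<noteq> 0" using nonsing[OF that] x by blast
    then show ?thesis
      by (intro exI[of _ "1 / norm (blinfun_apply J x)"])
        (simp add: dot_square_norm field_simps power2_eq_square)
  qed
  obtain a where a: "(a *\<^sub>R blinfun_apply J1 x) \<bullet> (a *\<^sub>R blinfun_apply J1 x) = 1"
    using normalise J by blast
  define K1 where "K1 = a *\<^sub>R J1"
  have K1: "K1 \<in> V" "blinfun_apply K1 x \<bullet> blinfun_apply K1 x = 1"
    using a J subspace_V by (auto simp: K1_def subspace_scale blinfun.scaleR_left)
  \<comment> \<open>Gram-Schmidt on the values at \<open>x\<close>: subtracting this multiple of
    \<open>K1\<close> makes \<open>L x\<close> orthogonal to \<open>K1 x\<close>, and independence
    of \<open>J1\<close>, \<open>J2\<close> keeps \<open>L\<close> nonzero.\<close>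
  define L where "L = J2 - (blinfun_apply J2 x \<bullet> blinfun_apply K1 x) *\<^sub>R K1"
  have L: "L \<in> V" unfolding L_def by (intro subspace_diff subspace_scale subspace_V J K1)
  have "L \<noteq> 0"
  proof
    assume "L = 0"
    then have "J2 = (blinfun_apply J2 x \<bullet> blinfun_apply K1 x) *\<^sub>R a *\<^sub>R J1" by (simp add: L_def K1_def)
    then show False using J(4) by (metis span_base span_scale singletonI)
  qed
  then obtain b where b: "(b *\<^sub>R blinfun_apply L x) \<bullet> (b *\<^sub>R blinfun_apply L x) = 1"
    using normalise L by blast
  define K2 where "K2 = b *\<^sub>R L"
  have K2: "K2 \<in> V" "blinfun_apply K2 x \<bullet> blinfun_apply K2 x = 1"
    using b L subspace_V by (auto simp: K2_def subspace_scale blinfun.scaleR_left)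
  have K12: "blinfun_apply K1 x \<bullet> blinfun_apply K2 x = 0"
    using K1(2) by (simp add: K2_def L_def blinfun.scaleR_left blinfun.diff_left inner_diff_right inner_commute)
  obtain n1 where n1: "skew_commutant W n1" "n1 x = blinfun_apply K1 x"
    using skew_commutant_exists[OF invar K1(1) x(1)] by blast
  obtain n2 where n2: "skew_commutant W n2" "n2 x = blinfun_apply K2 x"
    using skew_commutant_exists[OF invar K2(1) x(1)] by blast
  note D1 = skew_commutantD[OF n1(1)] and D2 = skew_commutantD[OF n2(1)]
  note anti = skew_commutant_anticommutator[OF W _ _ x(1,2)]
  \<comment> \<open>Since \<open>K1 x\<close>, \<open>K2 x\<close> are orthonormal, the Clifford
    relation makes \<open>n1\<close> and \<open>n2\<close> anticommuting square roots of minus the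
    identity on \<open>W\<close>.\<close>
  have n11: "n1 (n1 w) = - w" if "w \<in> W" for w
  proof -
    have "2 *\<^sub>R n1 (n1 w) = 2 *\<^sub>R (- w)"
      using anti[OF n1(1) n1(1) that] by (simp add: n1(2) K1(2) scaleR_2)
    then show ?thesis by (simp only: scaleR_cancel_left) simp
  qed
  have n22: "n2 (n2 w) = - w" if "w \<in> W" for w
  proof -
    have "2 *\<^sub>R n2 (n2 w) = 2 *\<^sub>R (- w)"
      using anti[OF n2(1) n2(1) that] by (simp add: n2(2) K2(2) scaleR_2)
    then show ?thesis by (simp only: scaleR_cancel_left) simp
  qed
  have n21: "n2 (n1 w) = - n1 (n2 w)" if "w \<in> W" for w
    using anti[OF n1(1) n2(1) that] by (simp add: n1(2) n2(2) K12 add_eq_0_iff)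
  \<comment> \<open>With \<open>x, e1, e2, e3\<close> as \<open>1, i, j, k\<close>, the tables below
    say that \<open>n1\<close> and \<open>n2\<close> are left multiplication by \<open>i\<close> and
    \<open>j\<close>.\<close>
  define e1 e2 e3 where "e1 = n1 x" and "e2 = n2 x" and "e3 = n1 (n2 x)"
  have eW: "e1 \<in> W" "e2 \<in> W" "e3 \<in> W"
    using x D1(2) D2(2) by (auto simp: e1_def e2_def e3_def)
  have neg: "n1 (- w) = - n1 w" "n2 (- w) = - n2 w" for w
    using linear_neg[OF D1(1)] linear_neg[OF D2(1)] by auto
  have tab1: "n1 x = e1" "n1 e1 = - x" "n1 e2 = e3" "n1 e3 = - e2"
    using n11 x eW by (auto simp: e1_def e2_def e3_def)
  have tab2: "n2 x = e2" "n2 e1 = - e3" "n2 e2 = - x" "n2 e3 = e1"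
    using n22 n21 x eW D1(2) D2(2) neg by (auto simp: e1_def e2_def e3_def)
  have self: "n1 w \<bullet> w = 0" "n2 w \<bullet> w = 0" if "w \<in> W" for w
    using D1(3)[OF that that] D2(3)[OF that that] by (simp_all add: inner_commute)
  have o: "x \<bullet> e1 = 0" "x \<bullet> e2 = 0" "e1 \<bullet> e2 = 0" "e1 \<bullet> e1 = 1" "e2 \<bullet> e2 = 1"
    using self[OF x(1)] K1(2) K2(2) K12 n1(2) n2(2) by (simp_all add: e1_def e2_def inner_commute)
  have o3: "x \<bullet> e3 = 0" "e2 \<bullet> e3 = 0" "e1 \<bullet> e3 = 0" "e3 \<bullet> e3 = 1"
    using D1(3)[OF x(1) eW(2)] self(1)[OF eW(2)] D2(3)[OF x(1) eW(3)] D1(3)[OF eW(2) eW(3)] o tab1 tab2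
      D1(3)[OF x(1) eW(3)]
    by (simp_all add: inner_commute)
  interpret F: frame4 x e1 e2 e3
    by unfold_locales (use x o o3 in auto)
  have act: "\<exists>c::real^3. blinfun_apply J x = c$1 *\<^sub>R e1 + c$2 *\<^sub>R e2 + c$3 *\<^sub>R e3" if J: "J \<in> V" for J
  proof -
    obtain m where m: "skew_commutant W m" "m x = blinfun_apply J x"
      using skew_commutant_exists[OF invar J x(1)] by blast
    define n3 where "n3 w = n1 (n2 w)" for w
    have n3: "skew_commutant W n3"
      unfolding skew_commutant_def
    proof (intro conjI ballI)
      show "linear n3" using linear_compose[OF D2(1) D1(1)] by (simp add: n3_def[abs_def] o_def)
      show "n3 w \<in> W" if "w \<in> W" for w using that D1(2) D2(2) by (simp add: n3_def)
      show "n3 v \<bullet> w = - (v \<bullet> n3 w)" if "v \<in> W" "w \<in> W" for v w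
      proof -
        have "n3 v \<bullet> w = v \<bullet> n2 (n1 w)"
          unfolding n3_def using that D1(2,3) D2(2,3) by simp
        then show ?thesis using n21[OF that(2)] by (simp add: n3_def)
      qed
      show "n3 (blinfun_apply J w) = blinfun_apply J (n3 w)" if "J \<in> V" "w \<in> W" for J w
        using that D1(2,4) D2(2,4) by (simp add: n3_def)
    qed
    define c :: "real^3" where "c = vector [m x \<bullet> e1, m x \<bullet> e2, m x \<bullet> e3]"
    \<comment> \<open>Removing the components along \<open>n1\<close>, \<open>n2\<close>,
      \<open>n3\<close> makes \<open>k x\<close> orthogonal to \<open>e1\<close>, \<open>e2\<close>,
      \<open>e3\<close>, so by the Clifford relation \<open>k\<close> anticommutes with all
      three.\<close>
    define k where "k w = m w - c$1 *\<^sub>R n1 w - c$2 *\<^sub>R n2 w - c$3 *\<^sub>R n3 w" for w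
    have k: "skew_commutant W k"
      unfolding k_def by (intro skew_commutant_diff skew_commutant_scale sub m n1 n2 n3)
    note Dk = skew_commutantD[OF k]
    have kx: "k x \<bullet> e1 = 0" "k x \<bullet> e2 = 0" "k x \<bullet> e3 = 0"
      by (simp_all add: k_def n3_def tab1 tab2 inner_diff_left F.frame c_def)
    have ac: "k (n1 w) = - n1 (k w)" "k (n2 w) = - n2 (k w)" "k (n3 w) = - n3 (k w)" if "w \<in> W" for w
      using anti[OF k n1(1) that] anti[OF k n2(1) that] anti[OF k n3 that] kx
      by (simp_all add: tab1 tab2 n3_def eq_neg_iff_add_eq_0)
    \<comment> \<open>Passing \<open>n1\<close> and then \<open>n2\<close> changes the sign twice,
      so at \<open>x\<close> the map \<open>k\<close> also commutes with \<open>n3 = n1 n2\<close>;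
      as \<open>n1\<close> and \<open>n2\<close> are invertible on \<open>W\<close>, this leaves
      only \<open>k x = 0\<close>.\<close>
    have "k (n3 x) = n3 (k x)"
      unfolding n3_def using ac(1)[OF D2(2)[OF x(1)]] ac(2)[OF x(1)] neg by simp
    then have "2 *\<^sub>R n3 (k x) = 0"
      using ac(3)[OF x(1)] by (metis scaleR_2 add.left_inverse)
    then have "n3 (k x) = 0" by simp
    then have "k x = 0"
      using n11[OF D2(2)[OF Dk(2)[OF x(1)]]] n22[OF Dk(2)[OF x(1)]]
        linear_0[OF D1(1)] linear_0[OF D2(1)] by (simp add: n3_def)
    then have "m x = c$1 *\<^sub>R e1 + c$2 *\<^sub>R e2 + c$3 *\<^sub>R e3"
      by (simp add: k_def n3_def tab1 tab2 algebra_simps)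
    then show ?thesis using m(2) by auto
  qed
  have acts: "\<exists>w. blinfun_apply J x = blinfun_apply (F.asd w) x \<and> blinfun_apply J e1 = blinfun_apply (F.asd w) e1 \<and>
      blinfun_apply J e2 = blinfun_apply (F.asd w) e2 \<and> blinfun_apply J e3 = blinfun_apply (F.asd w) e3" if J: "J \<in> V" for J
  proof -
    obtain c :: "real^3" where c: "blinfun_apply J x = c$1 *\<^sub>R e1 + c$2 *\<^sub>R e2 + c$3 *\<^sub>R e3" using act[OF J] by blast
    have "blinfun_apply J e1 = n1 (blinfun_apply J x)" "blinfun_apply J e2 = n2 (blinfun_apply J x)"
      "blinfun_apply J e3 = n1 (n2 (blinfun_apply J x))"
      using D1(4)[OF J] D2(4)[OF J] D2(2) x(1) by (simp_all add: e1_def e2_def e3_def)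
    \<comment> \<open>\<open>J\<close> commutes with \<open>n1\<close> and \<open>n2\<close>, so it
      is right multiplication by the imaginary quaternion \<open>c\<close>. As \<open>asd w\<close>
      is right multiplication by the conjugate of \<open>w\<close>, the witness is
      \<open>- c\<close>.\<close>
    then show ?thesis
      by (intro exI[of _ "- c"])
        (simp add: F.asd_frame c tab1 tab2 linear_add[OF D1(1)] linear_add[OF D2(1)]
          linear_scale[OF D1(1)] linear_scale[OF D2(1)] linear_diff[OF D1(1)] linear_neg[OF D1(1)])
  qed
  have on_space: "\<exists>w. \<forall>v\<in>F.space. blinfun_apply J v = blinfun_apply (F.asd w) v" if J: "J \<in> V" for J
    using acts[OF J] F.endo_eq_on_space by metis
  have "F.space \<subseteq> W" using x eW sub by (intro span_minimal) auto
  moreover have "invariant F.space"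
    unfolding invariant_def using on_space F.so_on_maps_into[OF F.asd_so_on] by (metis subspace_span)
  moreover have "F.space \<noteq> {0}" using x(3) span_base[of x "{x, e1, e2, e3}"] by auto
  ultimately have WF: "W = F.space" using W unfolding irreducible_sub_def by metis
  \<comment> \<open>The frame asked for is \<open>- x, e1, e2, e3\<close>, whose
    \<open>self_dual\<close> maps are the \<open>asd\<close> maps of the present one.\<close>
  show ?thesis
    using F.frame4_flip on_space WF F.space_flip by metis
qed

section \<open>Decomposition into quaternionic blocks\<close>

text \<open>\<open>S\<close> records the ideal through which \<open>V\<close> acts on
  \<open>W\<close>. Agreement is required on \<open>W\<close> only, since elements of
  \<open>S\<close> vanish on the complement and those of \<open>V\<close> need not.\<close>

definition quaternionic_block :: "'a set \<Rightarrow> 'a endo set \<Rightarrow> bool" where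
  "quaternionic_block W S \<longleftrightarrow> (\<exists>e0 e1 e2 e3. frame4 e0 e1 e2 e3 \<and> W = span {e0, e1, e2, e3} \<and>
     S = range (self_dual e0 e1 e2 e3) \<and>
     (\<forall>J\<in>V. \<exists>A\<in>S. \<forall>v\<in>W. blinfun_apply J v = blinfun_apply A v))"

lemma quaternionic_blockD:
  assumes "quaternionic_block W S"
  shows "subspace W" "dim W = 4" "so3_ideal_of_so4 S W" "subspace S" "S \<subseteq> so_on W"
    "\<And>J. J \<in> V \<Longrightarrow> \<exists>A\<in>S. \<forall>v\<in>W. blinfun_apply J v = blinfun_apply A v"
proof -
  obtain e0 e1 e2 e3 where e: "frame4 e0 e1 e2 e3" "W = span {e0, e1, e2, e3}"
     "S = range (self_dual e0 e1 e2 e3)"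
    and J: "\<And>J. J \<in> V \<Longrightarrow> \<exists>A\<in>S. \<forall>v\<in>W. blinfun_apply J v = blinfun_apply A v"
    using assms unfolding quaternionic_block_def by blast
  interpret frame4 e0 e1 e2 e3 by fact
  show "subspace W" "dim W = 4" "so3_ideal_of_so4 S W"
    using dim_space so3_ideal_sd e by simp_all
  show "subspace S" "S \<subseteq> so_on W"
    using lie_ideal_sd e unfolding lie_ideal_def by simp_all
qed (use assms in \<open>auto simp: quaternionic_block_def\<close>)

lemma irreducible_sub_quaternionic_block:
  assumes "irreducible_sub W" and "J1 \<in> V" "J2 \<in> V" "J1 \<noteq> 0" "J2 \<notin> span {J1}"
  shows "\<exists>S. quaternionic_block W S"
  using irreducible_sub_frame[OF assms] unfolding quaternionic_block_def by (metis rangeI)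

text \<open>Strong induction on the dimension: an irreducible \<open>W\<close> is split off, and
  \<open>S \<inter> W\<^sup>\<bottom>\<close> is again invariant because \<open>V\<close> is skew.
  The blocks form a set and serve as their own indices.\<close>

lemma quaternionic_block_decomposition:
  assumes J: "J1 \<in> V" "J2 \<in> V" "J1 \<noteq> 0" "J2 \<notin> span {J1}" and "invariant S"
  shows "\<exists>F. finite F \<and> (\<forall>W\<in>F. W \<subseteq> S \<and> (\<exists>s. quaternionic_block W s)) \<and>
    (\<forall>W\<in>F. \<forall>W'\<in>F. W \<noteq> W' \<longrightarrow> (\<forall>x\<in>W. \<forall>y\<in>W'. orthogonal x y)) \<and>
    (\<forall>v\<in>S. \<exists>g. (\<forall>W\<in>F. g W \<in> W) \<and> v = sum g F)"
  using \<open>invariant S\<close>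
proof (induction "dim S" arbitrary: S rule: less_induct)
  case less
  show ?case
  proof (cases "S = {0}")
    case True
    then show ?thesis by (intro exI[of _ "{}"]) simp
  next
    case False
    then obtain W where WS: "W \<subseteq> S" and W: "irreducible_sub W"
      using irreducible_sub_exists less.prems by blast
    have sub: "subspace W" "subspace S" and nz: "W \<noteq> {0}"
      and inv: "\<And>J v. J \<in> V \<Longrightarrow> v \<in> W \<Longrightarrow> blinfun_apply J v \<in> W"
        "\<And>J v. J \<in> V \<Longrightarrow> v \<in> S \<Longrightarrow> blinfun_apply J v \<in> S"
      using W less.prems by (auto simp: irreducible_sub_def invariant_def)
    define T where "T = S \<inter> W\<^sup>\<bottom>"
    have subT: "subspace T"
      unfolding T_def by (intro subspace_inter sub subspace_orthogonal_comp)
    have "blinfun_apply J v \<in> W\<^sup>\<bottom>" if "J \<in> V" "v \<in> W\<^sup>\<bottom>" for J v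
    proof -
      have "w \<bullet> blinfun_apply J v = 0" if w: "w \<in> W" for w
        using skew[OF \<open>J \<in> V\<close>, of w v] inv(1)[OF \<open>J \<in> V\<close> w] \<open>v \<in> W\<^sup>\<bottom>\<close>
        by (simp add: orthogonal_comp_def orthogonal_def)
      then show ?thesis by (simp add: orthogonal_comp_def orthogonal_def)
    qed
    then have invT: "invariant T"
      using subT inv(2) by (simp add: invariant_def T_def)
    have disj: "W \<inter> W\<^sup>\<bottom> = {0}" by (rule orthogonal_Int_0[OF sub(1)])
    have "T \<noteq> S"
    proof
      assume "T = S"
      then have "W \<subseteq> W\<^sup>\<bottom>" using WS by (auto simp: T_def)
      then show False using disj nz by auto
    qed
    then have "T \<subset> S" by (auto simp: T_def)
    then have "dim T < dim S"
      using subT sub by (intro dim_psubset) (metis span_eq_iff)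
    from less.hyps[OF this invT] obtain F where F: "finite F"
        "\<And>X. X \<in> F \<Longrightarrow> X \<subseteq> T \<and> (\<exists>s. quaternionic_block X s)"
        "\<And>X Y x y. X \<in> F \<Longrightarrow> Y \<in> F \<Longrightarrow> X \<noteq> Y \<Longrightarrow> x \<in> X \<Longrightarrow> y \<in> Y \<Longrightarrow> orthogonal x y"
      and sumF: "\<And>v. v \<in> T \<Longrightarrow> \<exists>g. (\<forall>X\<in>F. g X \<in> X) \<and> v = sum g F"
      by metis
    have orthW: "orthogonal x y" "orthogonal y x" if "x \<in> W" "X \<in> F" "y \<in> X" for x y X
    proof -
      have "y \<in> W\<^sup>\<bottom>" using F(2) that by (auto simp: T_def)
      then show "orthogonal x y" "orthogonal y x"
        using that(1) by (auto simp: orthogonal_comp_def orthogonal_commute)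
    qed
    \<comment> \<open>Members of \<open>F\<close> lie in the complement of the nonzero space
      \<open>W\<close>; hence \<open>W\<close> is a fresh index and its summand can be set by
      updating \<open>g\<close> at \<open>W\<close>.\<close>
    have "W \<notin> F"
    proof
      assume "W \<in> F"
      then have "W \<subseteq> W\<^sup>\<bottom>" using F(2) by (auto simp: T_def)
      then show False using disj nz by auto
    qed
    have sumW: "\<exists>g. (\<forall>X\<in>insert W F. g X \<in> X) \<and> v = sum g (insert W F)" if v: "v \<in> S" for v
    proof -
      obtain w z where wz: "w \<in> W" "z \<in> W\<^sup>\<bottom>" "v = w + z"
        using subspace_sum_orthogonal_comp[OF sub(1)] by (metis UNIV_I set_plus_elim)
      have "z = v - w" using wz(3) by simp
      then have "z \<in> S" using wz(1) v WS by (auto intro: subspace_diff[OF sub(2)])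
      then have "z \<in> T" using wz(2) by (simp add: T_def)
      then obtain g where g: "\<forall>X\<in>F. g X \<in> X" "z = sum g F" using sumF by blast
      have "sum (g(W := w)) F = sum g F"
        using \<open>W \<notin> F\<close> by (intro sum.cong) auto
      then have "v = sum (g(W := w)) (insert W F)"
        using F(1) \<open>W \<notin> F\<close> g wz by simp
      then show ?thesis
        using g(1) wz(1) by (intro exI[of _ "g(W := w)"]) auto
    qed
    show ?thesis
    proof (intro exI[of _ "insert W F"] conjI ballI impI)
      show "finite (insert W F)" using F(1) by simp
      show "X \<subseteq> S" if "X \<in> insert W F" for X
        using that F(2) WS by (auto simp: T_def)
      show "\<exists>s. quaternionic_block X s" if "X \<in> insert W F" for X
        using that F(2) irreducible_sub_quaternionic_block[OF W J] by blast
      show "orthogonal x y" if "X \<in> insert W F" "Y \<in> insert W F" "X \<noteq> Y" "x \<in> X" "y \<in> Y" for X Y x y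
        using that F(3) orthW by blast
      show "\<exists>g. (\<forall>X\<in>insert W F. g X \<in> X) \<and> v = sum g (insert W F)" if "v \<in> S" for v
        using sumW[OF that] .
    qed
  qed
qed

text \<open>Evaluation at \<open>e0\<close> is injective on \<open>V\<close> by non-singularity and
  takes values in the imaginary part \<open>span {e1, e2, e3}\<close>, which bounds the dimension by
  3; \<open>J1\<close> and \<open>J2\<close> give the lower bound.\<close>

lemma dim_V_quaternionic:
  assumes J: "J1 \<in> V" "J2 \<in> V" "J1 \<noteq> 0" "J2 \<notin> span {J1}" and W: "quaternionic_block W S"
  shows "dim V \<in> {2, 3}"
proof -
  obtain e0 e1 e2 e3 where e: "frame4 e0 e1 e2 e3" "W = span {e0, e1, e2, e3}"
    and on_W: "\<And>J. J \<in> V \<Longrightarrow> \<exists>w. \<forall>v\<in>W. blinfun_apply J v = blinfun_apply (self_dual e0 e1 e2 e3 w) v"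
    using W unfolding quaternionic_block_def by blast
  interpret frame4 e0 e1 e2 e3 by fact
  define f where "f J = blinfun_apply J e0" for J :: "'a endo"
  have lin: "linear f"
    by (rule linearI) (simp_all add: f_def blinfun.add_left blinfun.scaleR_left)
  obtain B where B: "B \<subseteq> V" "independent B" "V \<subseteq> span B" "card B = dim V"
    using basis_exists[of V] by blast
  have "span B = V"
    using B(1,3) subspace_V by (intro subset_antisym span_minimal)
  have inj: "inj_on f V"
  proof (rule inj_onI)
    fix J K assume JK: "J \<in> V" "K \<in> V" "f J = f K"
    then have "J - K \<in> V" "blinfun_apply (J - K) e0 = 0"
      using subspace_V by (auto simp: f_def blinfun.diff_left intro: subspace_diff)
    moreover have "e0 \<noteq> 0" using unit by auto
    ultimately show "J = K" using nonsing[of "J - K" e0] by auto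
  qed
  have "f J \<in> span {e1, e2, e3}" if "J \<in> V" for J
  proof -
    obtain w where "\<forall>v\<in>W. blinfun_apply J v = blinfun_apply (sd w) v" using on_W[OF \<open>J \<in> V\<close>] by blast
    then have "f J = w$1 *\<^sub>R e1 + w$2 *\<^sub>R e2 + w$3 *\<^sub>R e3"
      using span_base[of e0 "{e0, e1, e2, e3}"] by (simp add: f_def e(2) sd_frame)
    then show ?thesis by (simp add: span_add span_scale span_base)
  qed
  then have "f ` B \<subseteq> span {e1, e2, e3}" using B(1) by blast
  moreover have "independent (f ` B)"
    using linear_independent_injective_image[OF lin B(2)] inj \<open>span B = V\<close> by simp
  ultimately have fB: "finite (f ` B)" "card (f ` B) \<le> card {e1, e2, e3}"
    using independent_span_bound[of "{e1, e2, e3}" "f ` B"] by auto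
  have "card {e1, e2, e3} \<le> 3" by (simp add: card_insert_if)
  have injB: "inj_on f B" using inj B(1) by (rule inj_on_subset)
  have finB: "finite B" using fB(1) injB by (simp add: finite_image_iff)
  have "dim V \<le> 3"
    using fB(2) \<open>card {e1, e2, e3} \<le> 3\<close> card_image[OF injB] B(4) by simp
  moreover have "independent {J2, J1}"
    using J by (simp add: independent_insert)
  then have "card {J2, J1} \<le> card B"
    using independent_span_bound[OF finB, of "{J2, J1}"] J B(3) by auto
  moreover have "J2 \<noteq> J1" using J(4) span_base by blast
  ultimately show ?thesis using B(4) by auto
qed

lemma quaternionic_case:
  assumes J: "J1 \<in> V" "J2 \<in> V" "J1 \<noteq> 0" "J2 \<notin> span {J1}"
  shows "dim V \<in> {2, 3} \<and>
    (\<exists>(p::nat) (U :: nat \<Rightarrow> 'a set) (s :: nat \<Rightarrow> 'a endo set).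
       orthogonal_decomposition {1..p} U \<and>
       (\<forall>i\<in>{1..p}. dim (U i) = 4) \<and>
       (\<forall>i\<in>{1..p}. so3_ideal_of_so4 (s i) (U i)) \<and>
       independent_subspaces {1..p} s \<and>
       V \<subseteq> subspace_sum {1..p} s \<and>
       (\<forall>i\<in>{1..p}. inj_on (summand_proj {1..p} s i) V))"
proof -
  have "invariant UNIV" by (simp add: invariant_def)
  from quaternionic_block_decomposition[OF J this] obtain F where F: "finite F"
      "\<And>W. W \<in> F \<Longrightarrow> \<exists>s. quaternionic_block W s"
      "\<And>X Y x y. X \<in> F \<Longrightarrow> Y \<in> F \<Longrightarrow> X \<noteq> Y \<Longrightarrow> x \<in> X \<Longrightarrow> y \<in> Y \<Longrightarrow> orthogonal x y"
      "\<And>v. \<exists>g. (\<forall>W\<in>F. g W \<in> W) \<and> v = sum g F"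
    by (metis UNIV_I)
  obtain \<sigma> where \<sigma>: "\<And>W. W \<in> F \<Longrightarrow> quaternionic_block W (\<sigma> W)"
    using F(2) by metis
  obtain U where U: "bij_betw U {1..card F} F"
    using ex_bij_betw_nat_finite_1[OF F(1)] by blast
  define p where "p = card F"
  define s where "s i = \<sigma> (U i)" for i
  let ?I = "{1..p}"
  have UF: "U i \<in> F" if "i \<in> ?I" for i
    using bij_betwE[OF U, folded p_def] that by blast
  note block = quaternionic_blockD[OF \<sigma>[OF UF], folded s_def]
  have orth: "orthogonal x y" if "i \<in> ?I" "j \<in> ?I" "i \<noteq> j" "x \<in> U i" "y \<in> U j" for i j x y
  proof -
    have "U i \<noteq> U j"
      using inj_onD[OF bij_betw_imp_inj_on[OF U], folded p_def] that(1-3) by blast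
    then show ?thesis using F(3) UF that by blast
  qed
  have expand: "\<exists>g. (\<forall>i\<in>?I. g i \<in> U i) \<and> v = sum g ?I" for v
  proof -
    obtain g where g: "\<forall>W\<in>F. g W \<in> W" "v = sum g F" using F(4) by blast
    have "v = (\<Sum>i\<in>?I. g (U i))"
      using g(2) sum.reindex_bij_betw[OF U, of g] by (simp add: p_def)
    then show ?thesis
      using g(1) UF by (intro exI[of _ "\<lambda>i. g (U i)"]) simp
  qed
  have indepU: "independent_subspaces ?I U"
    unfolding independent_subspaces_def
  proof (intro conjI ballI allI impI)
    show "subspace (U i)" if "i \<in> ?I" for i using block(1)[OF that] .
    fix f i assume f: "(\<forall>i\<in>?I. f i \<in> U i) \<and> sum f ?I = 0" and i: "i \<in> ?I"
    \<comment> \<open>Pairing the vanishing sum with \<open>f i\<close> isolates the squared norm of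
      \<open>f i\<close>.\<close>
    have "0 = sum f ?I \<bullet> f i" using f by simp
    also have "\<dots> = (\<Sum>j\<in>?I. if j = i then f i \<bullet> f i else 0)"
      unfolding inner_sum_left
      by (rule sum.cong) (use f i orth in \<open>auto simp: orthogonal_def\<close>)
    also have "\<dots> = f i \<bullet> f i" using i by simp
    finally show "f i = 0" by simp
  qed
  have decomp: "orthogonal_decomposition ?I U"
    unfolding orthogonal_decomposition_def internal_direct_sum_def
  proof (intro conjI ballI impI)
    show "UNIV = subspace_sum ?I U"
      unfolding subspace_sum_def using expand by fast
  qed (use indepU orth in auto)
  \<comment> \<open>The summand \<open>f i\<close> vanishes on the complement of \<open>U i\<close>,
    which contains every other \<open>U j\<close>; so on \<open>U j\<close> only \<open>f j\<close>
    acts.\<close>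
  have sum_apply: "blinfun_apply (sum f ?I) v = blinfun_apply (f j) v"
    if f: "\<And>i. i \<in> ?I \<Longrightarrow> f i \<in> s i" and j: "j \<in> ?I" and v: "v \<in> U j" for f j v
  proof -
    have "blinfun_apply (f i) v = 0" if i: "i \<in> ?I" "i \<noteq> j" for i
    proof -
      have "v \<in> (U i)\<^sup>\<bottom>" using orth[OF i(1) j i(2) _ v] by (auto simp: orthogonal_comp_def)
      then show ?thesis using block(5)[OF i(1)] f[OF i(1)] by (auto simp: so_on_def)
    qed
    then have "(\<Sum>i\<in>?I. blinfun_apply (f i) v) = (\<Sum>i\<in>?I. if i = j then blinfun_apply (f j) v else 0)"
      by (intro sum.cong) auto
    then show ?thesis using j by (simp add: blinfun.sum_left)
  qed
  have indeps: "independent_subspaces ?I s"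
    unfolding independent_subspaces_def
  proof (intro conjI ballI allI impI)
    show "subspace (s i)" if "i \<in> ?I" for i using block(4)[OF that] .
    fix f i assume f: "(\<forall>i\<in>?I. f i \<in> s i) \<and> sum f ?I = 0" and i: "i \<in> ?I"
    show "f i = 0"
    proof (rule blinfun_eqI)
      fix v
      obtain w z where wz: "w \<in> U i" "z \<in> (U i)\<^sup>\<bottom>" "v = w + z"
        using subspace_sum_orthogonal_comp[OF block(1)[OF i]] by (metis UNIV_I set_plus_elim)
      have "blinfun_apply (f i) w = 0"
        using sum_apply[of f i w] f i wz(1) by simp
      moreover have "blinfun_apply (f i) z = 0"
        using block(5)[OF i] f i wz(2) unfolding so_on_def by blast
      ultimately show "blinfun_apply (f i) v = blinfun_apply 0 v"
        by (simp add: wz(3) blinfun.add_right)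
    qed
  qed
  \<comment> \<open>The operators by which \<open>J\<close> acts on the single blocks add up to
    \<open>J\<close>, as both sides agree on every \<open>U i\<close> and these span the
    space.\<close>
  have V_sum: "\<exists>f. (\<forall>i\<in>?I. f i \<in> s i) \<and> J = sum f ?I" if J: "J \<in> V" for J
  proof -
    have "\<forall>i\<in>?I. \<exists>A. A \<in> s i \<and> (\<forall>v\<in>U i. blinfun_apply J v = blinfun_apply A v)"
      using block(6)[OF _ J] by blast
    then obtain f where f: "\<And>i. i \<in> ?I \<Longrightarrow> f i \<in> s i"
        "\<And>i v. i \<in> ?I \<Longrightarrow> v \<in> U i \<Longrightarrow> blinfun_apply J v = blinfun_apply (f i) v"
      by metis
    have "J = sum f ?I"
    proof (rule blinfun_eqI)
      fix v
      obtain g where g: "\<forall>i\<in>?I. g i \<in> U i" "v = sum g ?I" using expand by blast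
      have "blinfun_apply J (g i) = blinfun_apply (sum f ?I) (g i)" if "i \<in> ?I" for i
        using sum_apply[of f i "g i"] f g(1) that by simp
      then show "blinfun_apply J v = blinfun_apply (sum f ?I) v"
        by (simp add: g(2) blinfun.sum_right)
    qed
    then show ?thesis using f(1) by blast
  qed
  have inj: "inj_on (summand_proj ?I s i) V" if i: "i \<in> ?I" for i
  proof (rule inj_onI)
    fix J K assume JK: "J \<in> V" "K \<in> V" "summand_proj ?I s i J = summand_proj ?I s i K"
    obtain f g where f: "\<forall>i\<in>?I. f i \<in> s i" "J = sum f ?I" and g: "\<forall>i\<in>?I. g i \<in> s i" "K = sum g ?I"
      using V_sum JK by meson
    have fg: "f i = g i"
      using JK(3) summand_proj_sum[OF indeps f(1) i] summand_proj_sum[OF indeps g(1) i] f(2) g(2) by simp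
    \<comment> \<open>Equal \<open>i\<close>-th components make \<open>J - K\<close> vanish on
      \<open>U i\<close>. This space has dimension 4, so \<open>J - K\<close> has a nonzero kernel
      vector and non-singularity yields \<open>J = K\<close>.\<close>
    have "\<not> U i \<subseteq> {0}" using block(2)[OF i] by (metis dim_eq_0 zero_neq_numeral)
    then obtain v where v: "v \<in> U i" "v \<noteq> 0" by blast
    have "blinfun_apply (J - K) v = 0"
      unfolding blinfun.diff_left f(2) g(2)
      using sum_apply[OF _ i v(1), of f] sum_apply[OF _ i v(1), of g] f(1) g(1) fg by simp
    moreover have "J - K \<in> V" using JK subspace_V by (intro subspace_diff)
    ultimately show "J = K" using nonsing[of "J - K" v] v(2) by auto
  qed
  \<comment> \<open>The dimension count takes place in a block, so one must exist: an empty
    decomposition would make the whole space zero and with it \<open>J1\<close>.\<close>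
  have "p \<noteq> 0"
  proof
    assume "p = 0"
    then have "v = 0" for v :: 'a using expand[of v] by simp
    then have "J1 = 0" by (intro blinfun_eqI) simp
    then show False using J by simp
  qed
  then have "1 \<in> ?I" by simp
  then have "dim V \<in> {2, 3}" using dim_V_quaternionic[OF J \<sigma>[OF UF]] by blast
  moreover have "V \<subseteq> subspace_sum ?I s" using V_sum unfolding subspace_sum_def by blast
  ultimately show ?thesis
    using decomp block(2,3) indeps inj by blast
qed

end

theorem corollary1:
  fixes V :: "'a::euclidean_space endo set"
    and ip :: "'a endo \<Rightarrow> 'a endo \<Rightarrow> real"
  assumes "subspace V" and "V \<subseteq> so" and "V \<noteq> {0}"
    and "inner_product_on V ip"
    and "non_singular V"
    and "GO_pair_centralizer_type V ip"
  shows "(dim V = 1 \<and> (\<exists>J \<in> so. endo_invertible J \<and> V = span {J})) \<or>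
         (dim V \<in> {2, 3} \<and>
          (\<exists>(p::nat) (U :: nat \<Rightarrow> 'a set) (s :: nat \<Rightarrow> 'a endo set).
             orthogonal_decomposition {1..p} U \<and>
             (\<forall>i\<in>{1..p}. dim (U i) = 4) \<and>
             (\<forall>i\<in>{1..p}. so3_ideal_of_so4 (s i) (U i)) \<and>
             independent_subspaces {1..p} s \<and>
             V \<subseteq> subspace_sum {1..p} s \<and>
             (\<forall>i\<in>{1..p}. inj_on (summand_proj {1..p} s i) V)))"
proof -
  interpret nonsingular_centralizer_type V
  proof
    show "subspace V" "V \<subseteq> so" by fact+
    show "\<exists>N\<in>so_centralizer V. blinfun_apply N x = blinfun_apply J x" if "J \<in> V" for J x
      using assms(6) that by (simp add: GO_pair_centralizer_type_def)
    fix J x assume J: "J \<in> V" "J \<noteq> 0" "blinfun_apply J x = 0"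
    then obtain B where "B o\<^sub>L J = id_blinfun"
      using assms(5) unfolding non_singular_def endo_invertible_def by blast
    then have "blinfun_apply (B o\<^sub>L J) x = x" by simp
    then show "x = 0" using J(3) by (simp add: blinfun.zero_right)
  qed
  obtain J where J: "J \<in> V" "J \<noteq> 0"
    using assms(1,3) subspace_0 by blast
  show ?thesis
  \<comment> \<open>Either \<open>V\<close> is the line through \<open>J\<close>, or an element
    outside this line supplies the second independent operator for the quaternionic case.\<close>
  proof (cases "V \<subseteq> span {J}")
    case True
    then have V: "V = span {J}"
      using J(1) assms(1) by (intro subset_antisym span_minimal) auto
    have "independent {J}" using J(2) by simp
    then have "dim V = card {J}" unfolding V by (rule dim_span_eq_card_independent)
    moreover have "endo_invertible J" using assms(5) J by (simp add: non_singular_def)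
    ultimately show ?thesis using V J(1) assms(2) by auto
  next
    case False
    then obtain K where "K \<in> V" "K \<notin> span {J}" by blast
    then show ?thesis using quaternionic_case[OF J(1) _ J(2)] by blast
  qed
qed

end
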